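(* Let $\alpha\in\mathcal{DP}_n$. If $1\in F(\alpha)$ or $n\in F(\alpha)$, then $x\alpha=x$ for all $x\in\mathrm{Dom}\,\alpha$ (equivalently, $\alpha$ is a partial identity).
   Context: Let $X_n=\{1,2,\dots,n\}$ and let $\mathcal{I}_n$ be the set of all partial injective maps of $X_n$ (including the empty map). $\mathcal{DP}_n$ is the set of all $\alpha\in\mathcal{I}_n$ with $|x-y|=|x\alpha-y\alpha|$ for all $x,y\in\mathrm{Dom}\,\alpha$ (partial isometries; $x\alpha$ denotes the image of $x$ under $\alpha$). $F(\alpha)=\{x\in\mathrm{Dom}\,\alpha: x\alpha=x\}$ is the set of fixed points of $\alpha$. *)

theory Defs
  imports Main
begin

text \<open>
  A partial map of \<open>X\<^sub>n = {1, \<dots>, n}\<close> is a map \<open>nat \<rightharpoonup> nat\<close> whose domain and range lie in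
  \<open>{1..n}\<close>; \<open>x\<alpha>\<close> is \<open>the (\<alpha> x)\<close> for \<open>x \<in> dom \<alpha>\<close>.
\<close>

definition partial_injections :: "nat \<Rightarrow> (nat \<rightharpoonup> nat) set" where
  "partial_injections n =
     {\<alpha>. dom \<alpha> \<subseteq> {1..n} \<and> ran \<alpha> \<subseteq> {1..n} \<and> inj_on \<alpha> (dom \<alpha>)}"

text \<open>Distances are taken in \<open>int\<close>, since subtraction on \<open>nat\<close> is truncated.\<close>

definition partial_isometries :: "nat \<Rightarrow> (nat \<rightharpoonup> nat) set" where
  "partial_isometries n =
     {\<alpha> \<in> partial_injections n. \<forall>x \<in> dom \<alpha>. \<forall>y \<in> dom \<alpha>.
        \<bar>int x - int y\<bar> = \<bar>int (the (\<alpha> x)) - int (the (\<alpha> y))\<bar>}"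

definition fixed_points :: "(nat \<rightharpoonup> nat) \<Rightarrow> nat set" where
  "fixed_points \<alpha> = {x \<in> dom \<alpha>. the (\<alpha> x) = x}"

definition partial_identity :: "nat \<Rightarrow> (nat \<rightharpoonup> nat) \<Rightarrow> bool" where
  "partial_identity n \<alpha> \<longleftrightarrow> (\<exists>A \<subseteq> {1..n}. \<alpha> = Some |` A)"

end

theory Submission
  imports Defs
begin

text \<open>A partial isometry that fixes \<open>e\<close> preserves each distance to
  \<open>e\<close>, so it sends \<open>x\<close> either to \<open>x\<close> or to the mirror image
  2e - x. If \<open>e\<close> is an endpoint of \<open>{1..n}\<close>, the whole interval lies on
  one side of \<open>e\<close>, so for x different from e the mirror image leaves the interval and
  only \<open>x\<close> remains.\<close>

theorem lemma1p4:
  fixes n :: nat and \<alpha> :: "nat \<rightharpoonup> nat"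
  assumes "\<alpha> \<in> partial_isometries n"
    and "1 \<in> fixed_points \<alpha> \<or> n \<in> fixed_points \<alpha>"
  shows "(\<forall>x \<in> dom \<alpha>. the (\<alpha> x) = x) \<and> partial_identity n \<alpha>"
proof
  have dom: "dom \<alpha> \<subseteq> {1..n}" and ran: "ran \<alpha> \<subseteq> {1..n}"
    and isometry: "\<And>x y. x \<in> dom \<alpha> \<Longrightarrow> y \<in> dom \<alpha> \<Longrightarrow>
      \<bar>int x - int y\<bar> = \<bar>int (the (\<alpha> x)) - int (the (\<alpha> y))\<bar>"
    using assms(1) by (auto simp: partial_isometries_def partial_injections_def)
  show fixed: "\<forall>x \<in> dom \<alpha>. the (\<alpha> x) = x"
  proof
    fix x assume x: "x \<in> dom \<alpha>"
    then have "the (\<alpha> x) \<in> ran \<alpha>"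
      by (auto intro: ranI)
    then have bounds: "x \<in> {1..n}" "the (\<alpha> x) \<in> {1..n}"
      using x dom ran by auto
    obtain e where e: "e \<in> dom \<alpha>" "the (\<alpha> e) = e" "e = 1 \<or> e = n"
      using assms(2) by (auto simp: fixed_points_def)
    have "\<bar>int x - int e\<bar> = \<bar>int (the (\<alpha> x)) - int e\<bar>"
      using isometry[OF x e(1)] e(2) by simp
    \<comment> \<open>Both points lie on the same side of the endpoint \<open>e\<close>, so the signs agree.\<close>
    then show "the (\<alpha> x) = x"
      using bounds e(3) by auto
  qed
  \<comment> \<open>The witness for the set \<open>A\<close> is the domain itself: on it every value
    is fixed, and off it both maps are \<open>None\<close>.\<close>
  have "\<alpha> = Some |` dom \<alpha>"
  proof
    fix x
    show "\<alpha> x = (Some |` dom \<alpha>) x"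
      using fixed by (cases "\<alpha> x") (force simp: restrict_map_def domIff)+
  qed
  then show "partial_identity n \<alpha>"
    using dom unfolding partial_identity_def by blast
qed

end
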